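(* Let $X$ be a countably infinite set, $\mathcal{F}$ a non-principal ultrafilter on $X$, and $\mathcal{I}$ the ideal of $\mathcal{F}$. Then the (unique) maximal inverse subsemigroup of $I_X$ which contains $\operatorname{Sym}(X)_{\{\mathcal{F}\}}$ but not $\operatorname{Sym}(X)$ is $$\mathcal{V}_{\mathcal{F}} = \{ f \in I_X \mid (\operatorname{dom}(f) \in \mathcal{I} \text{ and } \operatorname{im}(f) \in \mathcal{I}), \text{ or } (\forall \Sigma \subseteq X)\ (\Sigma f \in \mathcal{F} \Leftrightarrow \Sigma \in \mathcal{F}) \}.$$
   Context: For a set $X$, $I_X$ is the symmetric inverse monoid: the set of all bijections between subsets of $X$ (partial bijections, called charts) under composition of partial functions, written left to right (the image of $x$ under $f$ is $xf$). For $\Sigma \subseteq X$, $\Sigma f = \{ xf \mid x \in \Sigma \cap \operatorname{dom}(f)\}$. $\operatorname{Sym}(X) \subseteq I_X$ is the group of all permutations of $X$. The ideal of a filter $\mathcal{F}$ on $X$ is $\mathcal{I} = \{ \Sigma \subseteq X \mid X \setminus \Sigma \in \mathcal{F} \}$. The stabiliser of $\mathcal{F}$ is $\operatorname{Sym}(X)_{\{\mathcal{F}\}} = \{ f \in \operatorname{Sym}(X) \mid (\forall \Sigma \subseteq X)\ (\Sigma f \in \mathcal{F} \Leftrightarrow \Sigma \in \mathcal{F}) \}$. An inverse subsemigroup of $I_X$ is a subsemigroup closed under $f\mapsto f^{-1}$; a maximal inverse subsemigroup of $I_X$ is a proper inverse subsemigroup that is maximal under containment among the proper inverse subsemigroups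 of $I_X$. *)

theory Defs
  imports "HOL-Library.Countable_Set"
begin

text \<open>
  A chart on \<open>X\<close> is represented by its graph, a relation on \<open>X\<close>. With this encoding the
  left-to-right composite \<open>fg\<close> is \<open>f O g\<close>, the inverse is \<open>f\<inverse>\<close>, the domain and
  image are \<open>Domain f\<close> and \<open>Range f\<close>, and \<open>\<Sigma>f = {xf | x \<in> \<Sigma> \<inter> dom(f)}\<close> is \<open>f `` \<Sigma>\<close>.
\<close>

definition symmetric_inverse_monoid :: "'a set \<Rightarrow> 'a rel set" where
  "symmetric_inverse_monoid X =
    {f. f \<subseteq> X \<times> X \<and> single_valued f \<and> single_valued (f\<inverse>)}"

definition Sym :: "'a set \<Rightarrow> 'a rel set" where
  "Sym X = {f \<in> symmetric_inverse_monoid X. Domain f = X \<and> Range f = X}"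

definition inverse_subsemigroup :: "'a set \<Rightarrow> 'a rel set \<Rightarrow> bool" where
  "inverse_subsemigroup X M \<longleftrightarrow>
    M \<subseteq> symmetric_inverse_monoid X \<and>
    (\<forall>f\<in>M. \<forall>g\<in>M. f O g \<in> M) \<and> (\<forall>f\<in>M. f\<inverse> \<in> M)"

definition maximal_inverse_subsemigroup :: "'a set \<Rightarrow> 'a rel set \<Rightarrow> bool" where
  "maximal_inverse_subsemigroup X M \<longleftrightarrow>
    inverse_subsemigroup X M \<and> M \<noteq> symmetric_inverse_monoid X \<and>
    (\<forall>N. inverse_subsemigroup X N \<and> N \<noteq> symmetric_inverse_monoid X \<and> M \<subseteq> N \<longrightarrow> N = M)"

text \<open>Filters are proper families of subsets of the carrier set \<open>X\<close>.\<close>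

definition filter_on :: "'a set \<Rightarrow> 'a set set \<Rightarrow> bool" where
  "filter_on X F \<longleftrightarrow>
    F \<subseteq> Pow X \<and> X \<in> F \<and> {} \<notin> F \<and>
    (\<forall>A\<in>F. \<forall>B\<in>F. A \<inter> B \<in> F) \<and>
    (\<forall>A\<in>F. \<forall>B. A \<subseteq> B \<and> B \<subseteq> X \<longrightarrow> B \<in> F)"

definition ultrafilter_on :: "'a set \<Rightarrow> 'a set set \<Rightarrow> bool" where
  "ultrafilter_on X F \<longleftrightarrow>
    filter_on X F \<and> (\<forall>G. filter_on X G \<and> F \<subseteq> G \<longrightarrow> G = F)"

definition principal_on :: "'a set \<Rightarrow> 'a set set \<Rightarrow> bool" where
  "principal_on X F \<longleftrightarrow> (\<exists>A\<subseteq>X. F = {B. A \<subseteq> B \<and> B \<subseteq> X})"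

definition filter_ideal :: "'a set \<Rightarrow> 'a set set \<Rightarrow> 'a set set" where
  "filter_ideal X F = {A. A \<subseteq> X \<and> X - A \<in> F}"

definition filter_stabiliser :: "'a set \<Rightarrow> 'a set set \<Rightarrow> 'a rel set" where
  "filter_stabiliser X F = {f \<in> Sym X. \<forall>A\<subseteq>X. f `` A \<in> F \<longleftrightarrow> A \<in> F}"

definition ultrafilter_submonoid :: "'a set \<Rightarrow> 'a set set \<Rightarrow> 'a rel set" where
  "ultrafilter_submonoid X F =
    {f \<in> symmetric_inverse_monoid X.
      (Domain f \<in> filter_ideal X F \<and> Range f \<in> filter_ideal X F) \<or>
      (\<forall>A\<subseteq>X. f `` A \<in> F \<longleftrightarrow> A \<in> F)}"

end

theory Submission
  imports Defs
begin

text \<open>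
  An inverse subsemigroup that contains the stabiliser of \<open>F\<close> and a total chart \<open>t\<close> with image
  \<open>C \<notin> F\<close> contains every permutation \<open>g\<close>: conjugation by \<open>t\<close> turns \<open>g\<close> into a permutation of
  \<open>C\<close>, which extends by the identity to an element of the stabiliser. If it contains
  \<open>\<V>\<^sub>F\<close>, the same argument gives every chart.

  Such a \<open>t\<close> exists as soon as the subsemigroup contains some \<open>f \<notin> \<V>\<^sub>F\<close> and a total chart \<open>h\<close>
  with coinfinite image. Up to inversion, \<open>f\<close> maps a coinfinite member of \<open>F\<close> to a set outside
  \<open>F\<close>, and the stabiliser is transitive on the coinfinite members of \<open>F\<close>, so one can take
  \<open>t = h s f\<close> with \<open>s\<close> in the stabiliser. The monoid \<open>\<V>\<^sub>F\<close> contains a suitable \<open>h\<close>. A maximal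
  \<open>M\<close> not containing all permutations also does, because it lies neither in the proper
  inverse subsemigroup of charts that are total iff they are onto, nor in that of charts whose
  domain is cofinite iff their image is.
\<close>

section \<open>Charts\<close>

lemma sim_iff:
  "f \<in> symmetric_inverse_monoid X \<longleftrightarrow>
    f \<subseteq> X \<times> X \<and> (\<forall>x y z. (x, y) \<in> f \<longrightarrow> (x, z) \<in> f \<longrightarrow> y = z)
      \<and> (\<forall>x y z. (x, z) \<in> f \<longrightarrow> (y, z) \<in> f \<longrightarrow> x = y)"
  unfolding symmetric_inverse_monoid_def single_valued_def by blast

lemma sim_functional: "f \<in> symmetric_inverse_monoid X \<Longrightarrow> (x, y) \<in> f \<Longrightarrow> (x, z) \<in> f \<Longrightarrow> y = z"
  unfolding sim_iff by blast

lemma sim_injective: "f \<in> symmetric_inverse_monoid X \<Longrightarrow> (x, z) \<in> f \<Longrightarrow> (y, z) \<in> f \<Longrightarrow> x = y"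
  unfolding sim_iff by blast

lemma sim_subset: "f \<in> symmetric_inverse_monoid X \<Longrightarrow> f \<subseteq> X \<times> X"
  unfolding sim_iff by blast

lemma sim_converse: "f \<in> symmetric_inverse_monoid X \<Longrightarrow> f\<inverse> \<in> symmetric_inverse_monoid X"
  unfolding sim_iff by blast

lemma sim_comp:
  assumes "f \<in> symmetric_inverse_monoid X" "g \<in> symmetric_inverse_monoid X"
  shows "f O g \<in> symmetric_inverse_monoid X"
  using assms unfolding symmetric_inverse_monoid_def
  by (auto simp: converse_relcomp intro: single_valued_relcomp)

lemma sim_Id_on: "A \<subseteq> X \<Longrightarrow> Id_on A \<in> symmetric_inverse_monoid X"
  unfolding sim_iff by blast

lemma sim_Un:
  assumes "f \<in> symmetric_inverse_monoid X" "g \<in> symmetric_inverse_monoid X"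
    and "Domain f \<inter> Domain g = {}" "Range f \<inter> Range g = {}"
  shows "f \<union> g \<in> symmetric_inverse_monoid X"
  using assms unfolding symmetric_inverse_monoid_def single_valued_def by auto

lemma sim_finite_Image:
  assumes "f \<in> symmetric_inverse_monoid X" "finite A"
  shows "finite (f `` A)"
proof -
  have "f `` A \<subseteq> (\<lambda>x. THE y. (x, y) \<in> f) ` A"
  proof
    fix y assume "y \<in> f `` A"
    then obtain x where x: "x \<in> A" "(x, y) \<in> f" by blast
    then have "(THE y. (x, y) \<in> f) = y"
      using sim_functional[OF assms(1)] by blast
    then show "y \<in> (\<lambda>x. THE y. (x, y) \<in> f) ` A" using x(1) by blast
  qed
  then show ?thesis using assms(2) finite_surj by blast
qed

lemma Sym_I:
  "f \<in> symmetric_inverse_monoid X \<Longrightarrow> Domain f = X \<Longrightarrow> Range f = X \<Longrightarrow> f \<in> Sym X"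
  unfolding Sym_def by blast

lemma ex_chart:
  assumes "countable X" "A \<subseteq> X" "B \<subseteq> X" "infinite A" "infinite B"
  obtains g where "g \<in> symmetric_inverse_monoid X" "Domain g = A" "Range g = B"
proof -
  have "countable A" "countable B" using assms countable_subset by blast+
  then have "bij_betw (from_nat_into B \<circ> to_nat_on A) A B"
    using bij_betw_trans[OF to_nat_on_infinite bij_betw_from_nat_into] assms(4,5) by blast
  then obtain u where u: "bij_betw u A B" by blast
  let ?g = "{(x, u x) | x. x \<in> A}"
  have "Domain ?g = A" by blast
  moreover have "Range ?g = B" using u unfolding bij_betw_def by blast
  moreover have "?g \<in> symmetric_inverse_monoid X"
    using u assms(2,3) unfolding sim_iff bij_betw_def inj_on_def by blast
  ultimately show thesis using that by blast
qed

section \<open>Ultrafilters\<close>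

locale free_ultrafilter =
  fixes X :: "'a set" and F :: "'a set set"
  assumes countable: "countable X"
    and ultrafilter: "ultrafilter_on X F"
    and not_principal: "\<not> principal_on X F"
begin

abbreviation "I \<equiv> symmetric_inverse_monoid X"
abbreviation "S \<equiv> filter_stabiliser X F"
abbreviation "V \<equiv> ultrafilter_submonoid X F"

lemma F_subset: "A \<in> F \<Longrightarrow> A \<subseteq> X"
  and X_in: "X \<in> F"
  and empty_notin: "{} \<notin> F"
  and F_Int: "A \<in> F \<Longrightarrow> B \<in> F \<Longrightarrow> A \<inter> B \<in> F"
  and F_mono: "A \<in> F \<Longrightarrow> A \<subseteq> B \<Longrightarrow> B \<subseteq> X \<Longrightarrow> B \<in> F"
  using ultrafilter unfolding ultrafilter_on_def filter_on_def by (simp; blast)+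

text \<open>If neither \<open>A\<close> nor its complement were in \<open>F\<close>, then
  \<open>A\<close> would meet every member of \<open>F\<close>. The filter \<open>G\<close>
  generated by \<open>F\<close> and \<open>A\<close> would then be proper, contradicting the
  maximality of \<open>F\<close>.\<close>

lemma compl_in:
  assumes "A \<subseteq> X" "A \<notin> F"
  shows "X - A \<in> F"
proof (rule ccontr)
  assume n: "X - A \<notin> F"
  define G where "G = {B. B \<subseteq> X \<and> (\<exists>C\<in>F. C \<inter> A \<subseteq> B)}"
  have meets: "C \<inter> A \<noteq> {}" if "C \<in> F" for C
    using that n F_mono[of C "X - A"] F_subset by blast
  have "filter_on X G"
    unfolding filter_on_def
  proof (intro conjI ballI allI impI)
    fix B B' assume BB: "B \<in> G" "B' \<in> G"
    then obtain C C' where "C \<in> F" "C' \<in> F" "C \<inter> A \<subseteq> B" "C' \<inter> A \<subseteq> B'"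
      unfolding G_def by blast
    moreover from this have "(C \<inter> C') \<inter> A \<subseteq> B \<inter> B'" by blast
    ultimately have "\<exists>C\<in>F. C \<inter> A \<subseteq> B \<inter> B'" using F_Int by metis
    then show "B \<inter> B' \<in> G" using BB unfolding G_def by blast
  next
    fix B B' assume "B \<in> G" "B \<subseteq> B' \<and> B' \<subseteq> X"
    then show "B' \<in> G" unfolding G_def by blast
  qed (use X_in meets in \<open>auto simp: G_def\<close>)
  moreover have "F \<subseteq> G" using F_subset unfolding G_def by blast
  ultimately have "G = F" using ultrafilter unfolding ultrafilter_on_def by blast
  moreover have "A \<in> G" using assms X_in unfolding G_def by blast
  ultimately show False using assms by blast
qed

lemma compl_in_iff: "A \<subseteq> X \<Longrightarrow> X - A \<in> F \<longleftrightarrow> A \<notin> F"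
  using compl_in F_Int[of A "X - A"] empty_notin by (metis Diff_disjoint)

text \<open>Deleting a point \<open>x\<close> from a finite member leaves, by induction, a set
  outside \<open>F\<close>. Hence \<open>{x}\<close> is in \<open>F\<close>, and \<open>F\<close> is
  principal.\<close>

lemma F_infinite:
  assumes "A \<in> F"
  shows "infinite A"
proof
  assume "finite A"
  then show False using assms
  proof (induction A rule: finite_psubset_induct)
    case (psubset A)
    obtain x where x: "x \<in> A" using psubset.prems empty_notin by (metis ex_in_conv)
    have "A \<inter> (X - {x}) \<notin> F" using psubset.IH[of "A \<inter> (X - {x})"] x by blast
    then have "X - {x} \<notin> F" using F_Int psubset.prems by blast
    then have "{x} \<in> F" using compl_in_iff[of "{x}"] x psubset.prems F_subset by blast
    then have "F = {B. {x} \<subseteq> B \<and> B \<subseteq> X}"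
      using F_mono[of "{x}"] F_Int[of "{x}"] empty_notin F_subset
      by (auto) (metis Int_insert_left_if0 Int_empty_left)
    then show False using not_principal \<open>{x} \<in> F\<close> F_subset unfolding principal_on_def by blast
  qed
qed

lemma filter_ideal_iff: "A \<in> filter_ideal X F \<longleftrightarrow> A \<subseteq> X \<and> A \<notin> F"
  unfolding filter_ideal_def using compl_in_iff by blast

text \<open>The even and odd positions in an enumeration of \<open>A\<close> give two disjoint
  infinite halves, and one of them is in \<open>F\<close>. This is the source of members of
  \<open>F\<close> with infinite complement, and of the room needed to apply
  \<open>ex_chart\<close>.\<close>

lemma halve:
  assumes "A \<in> F"
  obtains E where "E \<in> F" "E \<subseteq> A" "infinite (A - E)"
proof -
  have "infinite A" "countable A"
    using assms F_infinite countable_subset[OF F_subset[OF assms] countable] by blast+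
  then have u: "bij_betw (from_nat_into A) UNIV A" by (simp add: bij_betw_from_nat_into)
  define P where "P = from_nat_into A ` {n. even n}"
  have inj: "inj (from_nat_into A)" using u unfolding bij_betw_def by blast
  have "A - P = from_nat_into A ` {n. odd n}"
  proof -
    have "A - P = from_nat_into A ` (UNIV - {n. even n})"
      using u inj unfolding P_def bij_betw_def by (simp add: image_set_diff)
    also have "UNIV - {n. even n} = {n::nat. odd n}" by blast
    finally show ?thesis .
  qed
  moreover have "infinite {n::nat. odd n}" "infinite {n::nat. even n}"
    unfolding infinite_nat_iff_unbounded
    by (metis mem_Collect_eq even_Suc less_Suc_eq lessI)+
  ultimately have "infinite P" "infinite (A - P)"
    using inj unfolding P_def by (metis finite_imageD inj_on_subset subset_UNIV)+
  moreover have "P \<subseteq> A" using u unfolding P_def bij_betw_def by blast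
  moreover have "P \<in> F \<or> A - P \<in> F"
  proof -
    have "A \<inter> (X - P) \<in> F" if "P \<notin> F"
      using that compl_in[of P] \<open>P \<subseteq> A\<close> assms F_subset F_Int by blast
    moreover have "A \<inter> (X - P) = A - P" using assms F_subset by blast
    ultimately show ?thesis by auto
  qed
  moreover have "A - (A - P) = P" using \<open>P \<subseteq> A\<close> by blast
  ultimately show thesis using that by (metis Diff_subset)
qed

section \<open>The stabiliser and the monoid of an ultrafilter\<close>

text \<open>By injectivity of \<open>f\<close>, the set \<open>A\<close> and its image have the same
  intersection with \<open>E\<close>, and membership in \<open>F\<close> depends only on that
  intersection.\<close>

lemma preserves_if_Id_on:
  assumes "f \<in> I" "E \<in> F" "Id_on E \<subseteq> f" "A \<subseteq> X"
  shows "f `` A \<in> F \<longleftrightarrow> A \<in> F"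
proof
  have fX: "f `` A \<subseteq> X" using sim_subset[OF assms(1)] by blast
  { assume "f `` A \<in> F"
    then have "f `` A \<inter> E \<in> F" using assms F_Int by blast
    moreover have "f `` A \<inter> E \<subseteq> A" using sim_injective[OF assms(1)] assms(3) by blast
    ultimately show "A \<in> F" using F_mono assms(4) by blast }
  { assume "A \<in> F"
    then have "A \<inter> E \<in> F" using assms F_Int by blast
    moreover have "A \<inter> E \<subseteq> f `` A" using assms(3) by blast
    ultimately show "f `` A \<in> F" using F_mono fX by blast }
qed

lemma stabiliser_if_Id_on:
  "f \<in> Sym X \<Longrightarrow> E \<in> F \<Longrightarrow> Id_on E \<subseteq> f \<Longrightarrow> f \<in> S"
  unfolding filter_stabiliser_def using preserves_if_Id_on unfolding Sym_def by blast

lemma V_if_Id_on: "f \<in> I \<Longrightarrow> E \<in> F \<Longrightarrow> Id_on E \<subseteq> f \<Longrightarrow> f \<in> V"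
  unfolding ultrafilter_submonoid_def using preserves_if_Id_on by blast

text \<open>The permutation \<open>s\<close> fixes pointwise a member \<open>E\<close> of
  \<open>F\<close> inside \<open>B \<inter> D\<close>, which puts it in the stabiliser. Choosing
  \<open>E\<close> by halving keeps \<open>B - E\<close> and \<open>D - E\<close> infinite, so
  countability gives bijections from \<open>B - E\<close> to \<open>D - E\<close> and from
  \<open>X - B\<close> to \<open>X - D\<close>.\<close>

lemma stabiliser_transitive:
  assumes "B \<in> F" "D \<in> F" "infinite (X - B)" "infinite (X - D)"
  obtains s where "s \<in> S" "s `` B = D"
proof -
  obtain E where E: "E \<in> F" "E \<subseteq> B \<inter> D" "infinite (B \<inter> D - E)"
    using halve[of "B \<inter> D"] assms F_Int by blast
  have sub: "B \<subseteq> X" "D \<subseteq> X" using assms F_subset by blast+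
  have inf: "infinite (B - E)" "infinite (D - E)"
    using E(3) finite_subset[of "B \<inter> D - E" "B - E"] finite_subset[of "B \<inter> D - E" "D - E"]
    by blast+
  obtain g where g: "g \<in> I" "Domain g = B - E" "Range g = D - E"
    using ex_chart[OF countable, of "B - E" "D - E"] inf sub by blast
  obtain k where k: "k \<in> I" "Domain k = X - B" "Range k = X - D"
    using ex_chart[OF countable, of "X - B" "X - D"] assms by blast
  have "Id_on E \<in> I" using sim_Id_on[of E X] E(2) sub by blast
  then have gE: "Id_on E \<union> g \<in> I" using sim_Un[OF _ g(1)] g by simp
  have s: "(Id_on E \<union> g) \<union> k \<in> I"
    by (rule sim_Un[OF gE k(1)]) (use g k E in auto)
  have "(Id_on E \<union> g) \<union> k \<in> Sym X"
    by (rule Sym_I[OF s]) (use g k E sub in \<open>auto simp: Domain_Un_eq Range_Un_eq\<close>)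
  moreover have "((Id_on E \<union> g) \<union> k) `` B = D"
  proof -
    have "k `` B = {}" using k(2) by blast
    moreover have "g `` B = D - E" using g(2,3) by blast
    moreover have "Id_on E `` B = E" using E(2) by blast
    ultimately show ?thesis using E(2) by blast
  qed
  ultimately show thesis using that stabiliser_if_Id_on E(1) by blast
qed

lemma V_iff:
  "f \<in> V \<longleftrightarrow> f \<in> I \<and> (Domain f \<notin> F \<and> Range f \<notin> F \<or> (\<forall>A\<subseteq>X. f `` A \<in> F \<longleftrightarrow> A \<in> F))"
proof -
  have "f \<in> I \<Longrightarrow> Domain f \<subseteq> X \<and> Range f \<subseteq> X" using sim_subset by blast
  then show ?thesis unfolding ultrafilter_submonoid_def filter_ideal_iff by blast
qed

lemma stabiliser_subset_V: "S \<subseteq> V"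
  unfolding filter_stabiliser_def ultrafilter_submonoid_def Sym_def by blast

text \<open>If \<open>f\<close> preserves membership in \<open>F\<close>, then its image is in
  \<open>F\<close>, being the image of \<open>X\<close>. The preimage of \<open>A\<close> is mapped
  by \<open>f\<close> onto the part of \<open>A\<close> in that image, and intersecting with a
  member of \<open>F\<close> does not affect membership.\<close>

lemma V_converse:
  assumes "f \<in> V"
  shows "f\<inverse> \<in> V"
proof -
  have f: "f \<in> I" using assms V_iff by blast
  have "f\<inverse> `` A \<in> F \<longleftrightarrow> A \<in> F" if p: "\<forall>A\<subseteq>X. f `` A \<in> F \<longleftrightarrow> A \<in> F" and A: "A \<subseteq> X" for A
  proof -
    have "f `` X \<in> F" using p X_in by blast
    moreover have "f `` (f\<inverse> `` A) = A \<inter> f `` X"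
      using sim_functional[OF f] sim_subset[OF f] by blast
    moreover have "f\<inverse> `` A \<subseteq> X" using sim_subset[OF f] by blast
    ultimately show ?thesis using p A F_Int F_mono by (metis inf_le1)
  qed
  then show ?thesis using assms sim_converse[OF f] unfolding V_iff by auto
qed

lemma V_comp:
  assumes "f \<in> V" "g \<in> V"
  shows "f O g \<in> V"
proof -
  have f: "f \<in> I" and g: "g \<in> I" using assms V_iff by blast+
  then have fg: "f O g \<in> I" by (rule sim_comp)
  have sub: "Domain f \<subseteq> X" "Range f \<subseteq> X" "Domain g \<subseteq> X" "Range g \<subseteq> X"
    "Domain (f O g) \<subseteq> X" "Range (f O g) \<subseteq> X"
    using sim_subset[OF f] sim_subset[OF g] by blast+
  have small_dom: "Domain f \<notin> F \<Longrightarrow> Domain (f O g) \<notin> F"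
    using F_mono[of "Domain (f O g)" "Domain f"] sub by blast
  have small_ran: "Range g \<notin> F \<Longrightarrow> Range (f O g) \<notin> F"
    using F_mono[of "Range (f O g)" "Range g"] sub by blast
  \<comment> \<open>Two charts with domains and images outside \<open>F\<close> fall under the
    fourth case, where monotonicity settles both ends of the composite. In the mixed cases
    monotonicity settles one end, and the preserving factor settles the other.\<close>
  consider "\<forall>A\<subseteq>X. f `` A \<in> F \<longleftrightarrow> A \<in> F" "\<forall>A\<subseteq>X. g `` A \<in> F \<longleftrightarrow> A \<in> F"
    | "Domain f \<notin> F" "Range f \<notin> F" "\<forall>A\<subseteq>X. g `` A \<in> F \<longleftrightarrow> A \<in> F"
    | "Domain g \<notin> F" "Range g \<notin> F" "\<forall>A\<subseteq>X. f `` A \<in> F \<longleftrightarrow> A \<in> F"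
    | "Domain f \<notin> F" "Range g \<notin> F"
    using assms unfolding V_iff by blast
  then show ?thesis
  proof cases
    case 1
    have "(f O g) `` A \<in> F \<longleftrightarrow> A \<in> F" if "A \<subseteq> X" for A
    proof -
      have "f `` A \<subseteq> X" using sub by blast
      then show ?thesis using 1 that by (simp add: relcomp_Image)
    qed
    then show ?thesis using fg V_iff by blast
  next
    case 2
    have "Range (f O g) = g `` Range f" by blast
    then have "Range (f O g) \<notin> F" using 2 sub by simp
    then show ?thesis using fg small_dom 2 V_iff by blast
  next
    case 3
    have "f `` Domain (f O g) \<subseteq> Domain g" using sim_functional[OF f] by blast
    then have "f `` Domain (f O g) \<notin> F" using 3 F_mono sub by blast
    then have "Domain (f O g) \<notin> F" using 3 sub by blast
    then show ?thesis using fg small_ran 3 V_iff by blast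
  next
    case 4
    then show ?thesis using fg small_ran small_dom V_iff by blast
  qed
qed

lemma V_inverse_subsemigroup: "inverse_subsemigroup X V"
  unfolding inverse_subsemigroup_def using V_comp V_converse V_iff by blast

text \<open>The witness is an involution swapping a coinfinite member of \<open>F\<close> with its
  complement. It is total, and \<open>X\<close> is in \<open>F\<close>, so the first alternative in
  \<open>V\<close> fails too.\<close>

lemma Sym_not_subset_V: "\<not> Sym X \<subseteq> V"
proof -
  obtain E where E: "E \<in> F" "E \<subseteq> X" "infinite (X - E)" using halve X_in by blast
  then obtain g where g: "g \<in> I" "Domain g = E" "Range g = X - E"
    using ex_chart[OF countable, of E "X - E"] F_infinite by blast
  have i: "g \<union> g\<inverse> \<in> I" by (rule sim_Un[OF g(1) sim_converse[OF g(1)]]) (use g in auto)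
  have d: "Domain (g \<union> g\<inverse>) = X" "Range (g \<union> g\<inverse>) = X" using g E by auto
  then have "g \<union> g\<inverse> \<in> Sym X" using Sym_I i by blast
  moreover have "(g \<union> g\<inverse>) `` E = X - E" using g by blast
  then have "g \<union> g\<inverse> \<notin> V"
    using E compl_in_iff[of E] X_in unfolding V_iff d by auto
  ultimately show ?thesis by blast
qed

text \<open>If exactly one of domain and image is in \<open>F\<close>, that set is the witness.
  Otherwise both are in \<open>F\<close>, since \<open>f\<close> is not in \<open>V\<close>, and
  some \<open>A\<close> violates the equivalence: either its part in the domain is moved out of
  \<open>F\<close>, or its image is moved out of \<open>F\<close> by the inverse.\<close>

lemma not_V_moves:
  assumes "f \<in> I" "f \<notin> V"
  shows "(\<exists>A\<in>F. A \<subseteq> Domain f \<and> f `` A \<notin> F) \<or> (\<exists>A\<in>F. A \<subseteq> Domain (f\<inverse>) \<and> f\<inverse> `` A \<notin> F)"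
proof -
  have sub: "Domain f \<subseteq> X" "Range f \<subseteq> X" using sim_subset[OF assms(1)] by blast+
  have im: "f `` Domain f = Range f" "f\<inverse> `` Range f = Domain f" by blast+
  show ?thesis
  proof (cases "Domain f \<in> F \<longleftrightarrow> Range f \<in> F")
    case False
    then show ?thesis using im by (metis Domain_converse order_refl)
  next
    case True
    then have d: "Domain f \<in> F" using assms V_iff by blast
    obtain A where A: "A \<subseteq> X" "f `` A \<in> F \<longleftrightarrow> A \<notin> F" using assms V_iff by blast
    have a: "f `` (A \<inter> Domain f) = f `` A" by blast
    have b: "f\<inverse> `` (f `` A) = A \<inter> Domain f" using sim_injective[OF assms(1)] by blast
    show ?thesis
    proof (cases "A \<in> F")
      case True
      then have "A \<inter> Domain f \<in> F" "f `` (A \<inter> Domain f) \<notin> F" using A a d F_Int by auto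
      then show ?thesis by blast
    next
      case False
      then have "f `` A \<in> F" "f\<inverse> `` (f `` A) \<notin> F"
        using A b F_mono[of "A \<inter> Domain f" A] by auto
      moreover have "f `` A \<subseteq> Domain (f\<inverse>)" by blast
      ultimately show ?thesis by blast
    qed
  qed
qed

section \<open>Subsemigroups not contained in the monoid of an ultrafilter\<close>

lemma total_chart_small_range:
  assumes N: "inverse_subsemigroup X N" "S \<subseteq> N" "\<not> N \<subseteq> V"
    and h: "h \<in> N" "Domain h = X" "infinite (X - Range h)"
  obtains t where "t \<in> N" "Domain t = X" "Range t \<notin> F"
proof (cases "Range h \<in> F")
  case False
  then show thesis using that h by blast
next
  case True
  have comp: "f O g \<in> N" if "f \<in> N" "g \<in> N" for f g
    using N that unfolding inverse_subsemigroup_def by blast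
  obtain f0 where f0: "f0 \<in> N" "f0 \<in> I" "f0\<inverse> \<in> N" "f0 \<notin> V"
    using N unfolding inverse_subsemigroup_def by blast
  obtain f A where f: "f \<in> N" "A \<in> F" "A \<subseteq> Domain f" "f `` A \<notin> F"
    using not_V_moves[OF f0(2,4)] f0(1,3) by blast
  \<comment> \<open>Passing from \<open>A\<close> to \<open>D\<close> secures an infinite
    complement, as transitivity of the stabiliser requires.\<close>
  obtain D where D: "D \<in> F" "D \<subseteq> A" "infinite (A - D)" using halve f(2) by blast
  have "infinite (X - D)"
    using D(3) finite_subset[of "A - D" "X - D"] F_subset[OF f(2)] by blast
  then obtain s where s: "s \<in> S" "s `` Range h = D"
    using stabiliser_transitive[OF True D(1) h(3)] by blast
  have fX: "f \<subseteq> X \<times> X" and hX: "h \<subseteq> X \<times> X"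
    using f(1) h(1) N(1) sim_subset unfolding inverse_subsemigroup_def by blast+
  have sX: "Domain s = X" using s(1) unfolding filter_stabiliser_def Sym_def by blast
  \<comment> \<open>The image of \<open>h\<close> is carried by \<open>s\<close> onto
    \<open>D\<close>, which lies in the domain of \<open>f\<close>; so the composite stays total,
    and its image lies within that of \<open>A\<close> under \<open>f\<close>.\<close>
  have "h O s O f \<in> N" using comp h(1) s(1) f(1) N(2) by blast
  moreover have "Domain (h O s O f) = X"
  proof
    show "Domain (h O s O f) \<subseteq> X" using h(2) by blast
    show "X \<subseteq> Domain (h O s O f)"
    proof
      fix x assume "x \<in> X"
      then obtain y where y: "(x, y) \<in> h" using h(2) by blast
      then have "y \<in> Domain s" using hX sX by blast
      then obtain z where z: "(y, z) \<in> s" by blast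
      then have "z \<in> D" using s(2) y by blast
      then show "x \<in> Domain (h O s O f)" using D(2) f(3) y z by blast
    qed
  qed
  moreover have "Range (h O s O f) \<notin> F"
  proof -
    have "Range (h O s O f) = f `` (s `` Range h)" by blast
    also have "\<dots> \<subseteq> f `` A" using s(2) D(2) by blast
    finally show ?thesis using F_mono[of _ "f `` A"] f(4) fX by blast
  qed
  ultimately show thesis using that by blast
qed

lemma conjugate_conjugate:
  assumes "t \<in> I" "Domain t = X" "g \<subseteq> X \<times> X"
  shows "t O (t\<inverse> O g O t) O t\<inverse> = g"
proof -
  have "t O t\<inverse> = Id_on X"
    using sim_injective[OF assms(1)] assms(2) by (auto simp: Id_on_def)
  then have "t O (t\<inverse> O g O t) O t\<inverse> = Id_on X O g O Id_on X" by (metis O_assoc)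
  also have "\<dots> = g" using assms(3) by blast
  finally show ?thesis .
qed

lemma Sym_subset_if_total_chart:
  assumes N: "inverse_subsemigroup X N" "S \<subseteq> N"
    and t: "t \<in> N" "Domain t = X" "Range t \<notin> F"
  shows "Sym X \<subseteq> N"
proof
  fix g assume g: "g \<in> Sym X"
  have tI: "t \<in> I" using N t unfolding inverse_subsemigroup_def by blast
  have gI: "g \<in> I" "Domain g = X" "Range g = X" using g unfolding Sym_def by auto
  define k where "k = t\<inverse> O g O t"
  let ?p = "k \<union> Id_on (X - Range t)"
  have tX: "Range t \<subseteq> X" using sim_subset[OF tI] by blast
  have kI: "k \<in> I" unfolding k_def by (intro sim_comp sim_converse gI(1) tI)
  have kd: "Domain k = Range t" "Range k = Range t"
    unfolding k_def using t(2) gI by blast+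
  have pI: "?p \<in> I" by (rule sim_Un[OF kI sim_Id_on]) (use kd in auto)
  have "?p \<in> Sym X" by (rule Sym_I[OF pI]) (use kd tX in \<open>auto simp: Domain_Un_eq Range_Un_eq\<close>)
  then have "?p \<in> S" using stabiliser_if_Id_on[of ?p "X - Range t"] compl_in tX t(3) by blast
  then have "t O ?p O t\<inverse> \<in> N" using N t(1) unfolding inverse_subsemigroup_def by blast
  \<comment> \<open>The identity part of \<open>?p\<close> lives off the image of \<open>t\<close>,
    so composing with \<open>t\<close> discards it.\<close>
  moreover have "t O ?p O t\<inverse> = t O k O t\<inverse>" by blast
  moreover have "\<dots> = g"
    unfolding k_def by (rule conjugate_conjugate[OF tI t(2) sim_subset[OF gI(1)]])
  ultimately show "g \<in> N" by simp
qed

text \<open>Fixing a member \<open>D\<close> of \<open>F\<close> pointwise ensures membership in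
  \<open>V\<close>, while the rest of \<open>X\<close> is squeezed into \<open>E - D\<close>,
  leaving the infinite set \<open>X - E\<close> uncovered.\<close>

lemma ex_total_chart_V:
  obtains h where "h \<in> V" "Domain h = X" "infinite (X - Range h)"
proof -
  obtain E where E: "E \<in> F" "E \<subseteq> X" "infinite (X - E)" using halve X_in by blast
  obtain D where D: "D \<in> F" "D \<subseteq> E" "infinite (E - D)" using halve E(1) by blast
  have "infinite (X - D)" using E(3) D(2) finite_subset[of "X - E" "X - D"] by blast
  then obtain g where g: "g \<in> I" "Domain g = X - D" "Range g = E - D"
    using ex_chart[OF countable, of "X - D" "E - D"] E D by blast
  have "Id_on D \<union> g \<in> I"
    by (rule sim_Un[OF sim_Id_on g(1)]) (use g D E in auto)
  then have "Id_on D \<union> g \<in> V" using V_if_Id_on[of _ D] D(1) by blast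
  moreover have "Domain (Id_on D \<union> g) = X" using g D E by blast
  moreover have "Range (Id_on D \<union> g) = E" using g D by (auto simp: Range_Un_eq)
  ultimately show thesis using that E(3) by metis
qed

lemma V_maximal: "maximal_inverse_subsemigroup X V"
  unfolding maximal_inverse_subsemigroup_def
proof (intro conjI allI impI)
  show "inverse_subsemigroup X V" by (rule V_inverse_subsemigroup)
  show "V \<noteq> I" using Sym_not_subset_V unfolding Sym_def by blast
  fix N assume N: "inverse_subsemigroup X N \<and> N \<noteq> I \<and> V \<subseteq> N"
  show "N = V"
  proof (rule ccontr)
    assume "N \<noteq> V"
    then have nV: "\<not> N \<subseteq> V" using N by blast
    obtain h where h: "h \<in> V" "Domain h = X" "infinite (X - Range h)" using ex_total_chart_V .
    have "S \<subseteq> N" using N stabiliser_subset_V by blast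
    then obtain t where t: "t \<in> N" "Domain t = X" "Range t \<notin> F"
      using total_chart_small_range[OF _ _ nV] N h by blast
    have tI: "t \<in> I" using N t unfolding inverse_subsemigroup_def by blast
    have "g \<in> N" if g: "g \<in> I" for g
    proof -
      \<comment> \<open>The conjugate of an arbitrary chart has domain and image inside the image of
        \<open>t\<close>, hence outside \<open>F\<close>, so it belongs to \<open>V\<close> by the
        first alternative.\<close>
      let ?k = "t\<inverse> O g O t"
      have "?k \<in> I" using sim_comp sim_converse g tI by blast
      moreover have "Domain ?k \<subseteq> Range t" "Range ?k \<subseteq> Range t" "Range t \<subseteq> X"
        using sim_subset[OF tI] by blast+
      then have "Domain ?k \<notin> F" "Range ?k \<notin> F" using F_mono t(3) by blast+
      ultimately have "?k \<in> N" using N V_iff by blast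
      then have "t O ?k O t\<inverse> \<in> N" using N t(1) unfolding inverse_subsemigroup_def by blast
      then show ?thesis using conjugate_conjugate[OF tI t(2) sim_subset[OF g]] by simp
    qed
    then show False using N unfolding inverse_subsemigroup_def by blast
  qed
qed

section \<open>Maximal subsemigroups not containing the symmetric group\<close>

text \<open>\<open>P\<close> is a notion of smallness for complements. Emptiness yields the charts
  that are total iff they are onto; finiteness yields those whose domain is cofinite iff their image
  is.\<close>

definition balanced :: "('a set \<Rightarrow> bool) \<Rightarrow> 'a rel set" where
  "balanced P = {f \<in> I. P (X - Domain f) \<longleftrightarrow> P (X - Range f)}"

lemma balanced_inverse_subsemigroup:
  assumes mono: "\<And>A B. P B \<Longrightarrow> A \<subseteq> B \<Longrightarrow> P A"
    and union: "\<And>A B. P A \<Longrightarrow> P B \<Longrightarrow> P (A \<union> B)"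
    and image: "\<And>f A. f \<in> I \<Longrightarrow> P A \<Longrightarrow> P (f `` A)"
  shows "inverse_subsemigroup X (balanced P)"
proof -
  have dir: "P (X - Range (f O g))"
    if fg: "f \<in> balanced P" "g \<in> balanced P" "P (X - Domain (f O g))" for f g
  proof -
    have I: "f \<in> I" "g \<in> I" using fg unfolding balanced_def by blast+
    then have s: "f \<subseteq> X \<times> X" "g \<subseteq> X \<times> X" using sim_subset by blast+
    have "P (X - Domain f)" using fg(3) by (rule mono) blast
    then have f: "P (X - Range f)" using fg(1) unfolding balanced_def by blast
    \<comment> \<open>A point outside the domain of \<open>g\<close> is either missed by
      \<open>f\<close> or the image of a point where the composite is undefined.\<close>
    have "X - Domain g \<subseteq> (X - Range f) \<union> f `` (X - Domain (f O g))"
      using s sim_functional[OF I(1)] by blast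
    then have "P (X - Domain g)" using mono union f image[OF I(1) fg(3)] by metis
    then have g: "P (X - Range g)" using fg(2) unfolding balanced_def by blast
    have "X - Range (f O g) \<subseteq> (X - Range g) \<union> g `` (X - Range f)"
      using s by blast
    then show ?thesis using mono union g image[OF I(2) f] by metis
  qed
  have conv: "f\<inverse> \<in> balanced P" if "f \<in> balanced P" for f
    using that sim_converse unfolding balanced_def by auto
  have comp: "f O g \<in> balanced P" if fg: "f \<in> balanced P" "g \<in> balanced P" for f g
  proof -
    have "f O g \<in> I" using fg sim_comp unfolding balanced_def by blast
    moreover have "P (X - Domain (f O g)) \<Longrightarrow> P (X - Range (f O g))" using dir fg by blast
    \<comment> \<open>The reverse implication is \<open>dir\<close> for the inverse composite, whose
      domain is the image of \<open>f O g\<close>.\<close>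
    moreover have "P (X - Range (f O g)) \<Longrightarrow> P (X - Domain (f O g))"
      using dir[OF conv[OF fg(2)] conv[OF fg(1)]] by (simp flip: converse_relcomp)
    ultimately show ?thesis unfolding balanced_def by blast
  qed
  have "balanced P \<subseteq> I" unfolding balanced_def by blast
  then show ?thesis unfolding inverse_subsemigroup_def using comp conv by blast
qed

text \<open>Compose \<open>h\<close> with the transposition of \<open>z\<close> and a point
  \<open>y\<close> missed by \<open>h\<close>. The transposition fixes a cofinite set, which is in
  \<open>F\<close>, so it lies in the stabiliser.\<close>

lemma total_chart_avoiding_point:
  assumes M: "inverse_subsemigroup X M" "S \<subseteq> M"
    and h: "h \<in> M" "Domain h = X" "Range h \<noteq> X" and z: "z \<in> X"
  obtains k where "k \<in> M" "Domain k = X" "z \<notin> Range k"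
proof -
  have hX: "h \<subseteq> X \<times> X" using M h sim_subset unfolding inverse_subsemigroup_def by blast
  then obtain y where y: "y \<in> X" "y \<notin> Range h" using h by blast
  let ?s = "{(y, z), (z, y)} \<union> Id_on (X - {y, z})"
  have sw: "{(y, z), (z, y)} \<in> I" unfolding sim_iff using y z by auto
  have sI: "?s \<in> I" by (rule sim_Un[OF sw sim_Id_on]) auto
  have "?s \<in> Sym X" by (rule Sym_I[OF sI]) (use y z in auto)
  moreover have "X - {y, z} \<in> F" using compl_in[of "{y, z}"] F_infinite y z by blast
  ultimately have "?s \<in> S" using stabiliser_if_Id_on by blast
  then have "h O ?s \<in> M" using M h unfolding inverse_subsemigroup_def by blast
  moreover have "Domain (h O ?s) = X" using h(2) hX y z by blast
  moreover have "z \<notin> Range (h O ?s)" using y by blast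
  ultimately show thesis using that by blast
qed

lemma total_chart_avoiding_finite:
  assumes M: "inverse_subsemigroup X M" "S \<subseteq> M"
    and h: "h \<in> M" "Domain h = X" "Range h \<noteq> X" and T: "finite T"
  shows "\<exists>k\<in>M. Domain k = X \<and> Range k \<inter> T = {}"
  using T
proof (induction T)
  case empty
  then show ?case using h by blast
next
  case (insert x T)
  then obtain k where k: "k \<in> M" "Domain k = X" "Range k \<inter> T = {}" by blast
  have kI: "k \<in> I" using M k unfolding inverse_subsemigroup_def by blast
  show ?case
  proof (cases "x \<in> Range k")
    case False
    then show ?thesis using k by blast
  next
    case True
    \<comment> \<open>To miss \<open>x\<close> as well, precompose \<open>k\<close> with a total
      chart missing the unique preimage \<open>z\<close> of \<open>x\<close>. Precomposition can
      only shrink the image, so \<open>T\<close> is still avoided.\<close>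
    then obtain z where z: "(z, x) \<in> k" by blast
    then have "z \<in> X" using k by blast
    then obtain l where l: "l \<in> M" "Domain l = X" "z \<notin> Range l"
      using total_chart_avoiding_point[OF M h] by blast
    have "l \<subseteq> X \<times> X" using l M sim_subset unfolding inverse_subsemigroup_def by blast
    then have "Domain (l O k) = X" using l k by blast
    moreover have "l O k \<in> M" using M l k unfolding inverse_subsemigroup_def by blast
    moreover have "x \<notin> Range (l O k)" using l(3) z sim_injective[OF kI] by blast
    then have "Range (l O k) \<inter> insert x T = {}" using k(3) by blast
    ultimately show ?thesis by blast
  qed
qed

text \<open>If \<open>M\<close> were contained in \<open>P\<close>, maximality would force
  \<open>P = M\<close>, and \<open>M\<close> would contain all permutations.\<close>

lemma maximal_not_subset:
  assumes M: "maximal_inverse_subsemigroup X M" "\<not> Sym X \<subseteq> M"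
    and P: "inverse_subsemigroup X P" "P \<noteq> I" "Sym X \<subseteq> P"
  shows "\<not> M \<subseteq> P"
  using assms unfolding maximal_inverse_subsemigroup_def by blast

lemma maximal_total_chart:
  assumes M: "maximal_inverse_subsemigroup X M" "S \<subseteq> M" "\<not> Sym X \<subseteq> M"
  obtains h where "h \<in> M" "Domain h = X" "infinite (X - Range h)"
proof -
  have Minv: "inverse_subsemigroup X M" using M unfolding maximal_inverse_subsemigroup_def by blast
  then have MI: "M \<subseteq> I" and comp: "\<And>f g. f \<in> M \<Longrightarrow> g \<in> M \<Longrightarrow> f O g \<in> M"
    and conv: "\<And>f. f \<in> M \<Longrightarrow> f\<inverse> \<in> M"
    unfolding inverse_subsemigroup_def by blast+
  \<comment> \<open>No membership of \<open>h0\<close> in \<open>M\<close> is claimed: it is total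
    with coinfinite image, so it shows that both balanced subsemigroups are proper.\<close>
  obtain h0 where h0: "h0 \<in> V" "Domain h0 = X" "infinite (X - Range h0)"
    using ex_total_chart_V .
  then have "X - Range h0 \<noteq> {}" by (metis finite.emptyI)
  then have "h0 \<in> I" "h0 \<notin> balanced (\<lambda>A. A = {})" "h0 \<notin> balanced finite"
    using h0 V_iff unfolding balanced_def by simp_all
  then have "balanced (\<lambda>A. A = {}) \<noteq> I" "balanced finite \<noteq> I" by blast+
  moreover have "Sym X \<subseteq> balanced (\<lambda>A. A = {})" "Sym X \<subseteq> balanced finite"
    unfolding Sym_def balanced_def by auto
  moreover have "inverse_subsemigroup X (balanced (\<lambda>A. A = {}))"
    by (rule balanced_inverse_subsemigroup) auto
  moreover have "inverse_subsemigroup X (balanced finite)"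
    by (rule balanced_inverse_subsemigroup) (use sim_finite_Image finite_subset in blast)+
  ultimately have "\<not> M \<subseteq> balanced (\<lambda>A. A = {})" "\<not> M \<subseteq> balanced finite"
    using maximal_not_subset[OF M(1,3)] by metis+
  then obtain f0 g0 where "f0 \<in> M" "f0 \<notin> balanced (\<lambda>A. A = {})"
    and "g0 \<in> M" "g0 \<notin> balanced finite" by blast
  then have f0: "f0 \<in> M" "(Domain f0 = X) \<noteq> (Range f0 = X)"
    and g0: "g0 \<in> M" "finite (X - Domain g0) \<noteq> finite (X - Range g0)"
    using MI sim_subset unfolding balanced_def by blast+
  \<comment> \<open>Inversion swaps domain and image, so each failure of balance can be oriented as
    required: \<open>f\<close> is total but not onto, and \<open>g\<close> has cofinite domain and
    coinfinite image.\<close>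
  obtain f where f: "f \<in> M" "Domain f = X" "Range f \<noteq> X"
    using f0 conv[OF f0(1)] by (metis Domain_converse Range_converse)
  obtain g where g: "g \<in> M" "finite (X - Domain g)" "infinite (X - Range g)"
    using g0 conv[OF g0(1)] by (metis Domain_converse Range_converse)
  \<comment> \<open>Since the image of \<open>k\<close> avoids the finite set where \<open>g\<close>
    is undefined, \<open>k O g\<close> is total, and it misses everything that \<open>g\<close>
    misses.\<close>
  obtain k where k: "k \<in> M" "Domain k = X" "Range k \<inter> (X - Domain g) = {}"
    using total_chart_avoiding_finite[OF Minv M(2) f g(2)] by blast
  have kX: "k \<subseteq> X \<times> X" using k MI sim_subset by blast
  have "k O g \<in> M" using comp k g by blast
  moreover have "Domain (k O g) = X" using k(2,3) kX by blast
  moreover have "infinite (X - Range (k O g))"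
    using g(3) finite_subset[of "X - Range g" "X - Range (k O g)"] by blast
  ultimately show thesis using that by blast
qed

lemma maximal_eq_V:
  assumes M: "maximal_inverse_subsemigroup X M" "S \<subseteq> M" "\<not> Sym X \<subseteq> M"
  shows "M = V"
proof -
  have Minv: "inverse_subsemigroup X M" using M unfolding maximal_inverse_subsemigroup_def by blast
  obtain h where h: "h \<in> M" "Domain h = X" "infinite (X - Range h)" using maximal_total_chart M .
  have "M \<subseteq> V"
  proof (rule ccontr)
    assume "\<not> M \<subseteq> V"
    then obtain t where "t \<in> M" "Domain t = X" "Range t \<notin> F"
      using total_chart_small_range[OF Minv M(2) _ h] by blast
    then show False using Sym_subset_if_total_chart[OF Minv M(2)] M(3) by blast
  qed
  \<comment> \<open>Since \<open>V\<close> is proper and contains \<open>M\<close>, maximality of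
    \<open>M\<close> gives equality.\<close>
  moreover have "V \<noteq> I" using V_maximal unfolding maximal_inverse_subsemigroup_def by blast
  ultimately show ?thesis
    using M(1) V_inverse_subsemigroup unfolding maximal_inverse_subsemigroup_def by blast
qed

end

theorem corollary3p41:
  fixes X :: "'a set" and F :: "'a set set"
  assumes "countable X" and "infinite X"
    and "ultrafilter_on X F" and "\<not> principal_on X F"
  shows "\<forall>M. maximal_inverse_subsemigroup X M \<and> filter_stabiliser X F \<subseteq> M \<and> \<not> Sym X \<subseteq> M
    \<longleftrightarrow> M = ultrafilter_submonoid X F"
proof -
  interpret free_ultrafilter X F using assms by (simp add: free_ultrafilter_def)
  show ?thesis
    using maximal_eq_V V_maximal stabiliser_subset_V Sym_not_subset_V by blast
qed

end
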